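(* With the quantities defined in the context, consider the max-min power control problem in epigraph form, in the variables $\{\nu_{li}^n\}_{1\le l\le L,\,1\le i\le K,\,1\le n\le N}$ and $\gamma$: $$\max_{\{\nu_{li}^n\},\gamma}\ \gamma\quad\text{s.t.}\quad \frac{\left|\sum_{n=1}^N\nu_{jk}^n\chi_{jk}^n\right|^2}{\sum_{l=1}^L\sum_{i=1}^K\sum_{n=1}^N(\nu_{li}^n)^2\zeta_{jk}^{lin}+\sum_{l\ne j}\left|\sum_{n=1}^N\nu_{lk}^n\xi_{jk}^{ln}\right|^2+\sigma_n^2}\ge\gamma\ \ \forall j,k,$$ $$\sum_{i=1}^K\sum_{n=1}^N(\nu_{li}^n)^2\,\mathrm{tr}\left(\mathbf{W}_{li}^n\mathbf{Q}_{li}^n(\mathbf{W}_{li}^n)^{\mathrm H}\right)\le 1\ \ \forall l,\qquad \nu_{li}^n\ge 0\ \ \forall l,i,n.$$ The constraint set of this optimization problem is convex and the optimization problem is quasi-concave. For a given constant value of $\gamma>0$, the optimization problem is re-written as the convex feasibility problem $$\max_{\{\nu_{li}^n\}}\ 0\quad\text{s.t.}\quad \|\mathbf{x}_{jk}\|\le\frac{1}{\sqrt{\gamma}}\left|\sum_{n=1}^N\nu_{jk}^n\chi_{jk}^n\right|\ \ \forall j,k,$$ $$\sum_{i=1}^K\sum_{n=1}^N(\nu_{li}^n)^2\,\mathrm{tr}\left(\mathbf{W}_{li}^n\mathbf{Q}_{li}^n(\mathbf{W}_{li}^n)^{\mathrm H}\right)\le 1\ \ \forall l,\qquad \nu_{li}^n\ge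 0\ \ \forall l,i,n,$$ where $\mathbf{x}_{jk}=[\tilde{\mathbf{x}}_{jk}\ \ \bar{\mathbf{x}}_{jk}\ \ \sqrt{\sigma_n^2}]^T$, with $\tilde{\mathbf{x}}_{jk}=[\tilde{\mathbf{x}}_{jk}^{11}\dots\tilde{\mathbf{x}}_{jk}^{li}\dots\tilde{\mathbf{x}}_{jk}^{LK}]$ and $\bar{\mathbf{x}}_{jk}=[\bar{\mathbf{x}}_{jk}^{11}\dots\bar{\mathbf{x}}_{jk}^{li}\dots\bar{\mathbf{x}}_{jk}^{LK}]$ (each running over all pairs $(l,i)$, $1\le l\le L$, $1\le i\le K$), where $$\tilde{\mathbf{x}}_{jk}^{li}=\left[\nu_{li}^1(\zeta_{jk}^{li1})^{1/2}\ \dots\ \nu_{li}^N(\zeta_{jk}^{liN})^{1/2}\right]$$ and $$\bar{\mathbf{x}}_{jk}^{li}=\begin{cases}\varrho_{jk}^{lk1}+\dots+\varrho_{jk}^{lkn}+\dots+\varrho_{jk}^{lkN}, & l\neq j,\\ 0, & l=j,\end{cases}$$ the $\varrho_{jk}^{lkn}$ being auxiliary variables introduced with $|\nu_{lk}^n\xi_{jk}^{ln}|^2\le(\varrho_{jk}^{lkn})^2$.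
   Context: Let $L,K,N,M\ge1$ be integers, $\rho_{\mathrm{tr}}>0$ (normalized pilot power), and $\sigma_n^2>0$ (a fixed noise variance; its subscript is not the summation index $n$). Indices range over $j,l\in\{1,\dots,L\}$ (cells), $k,i\in\{1,\dots,K\}$ (users in a cell), $n\in\{1,\dots,N\}$ (antenna sub-arrays in a cell, each with $M$ antennas). The real number $\nu_{li}^n$ is the downlink power control coefficient of sub-array $n$ of cell $l$ for user $i$ of cell $l$. For all $j,k,l,n$, $\mathbf{R}_{jk}^{ln}$ is an $M\times M$ channel covariance matrix (Hermitian positive semidefinite), that of the channel between user $k$ of cell $j$ and sub-array $n$ of cell $l$. Each user has a unit-norm pilot sequence, the pilots are orthogonal within each cell, and the same set of pilots is reused in every cell, user $k$ of every cell using the same pilot. The covariance matrix of the pilot observation is then $$\mathbf{Q}_{jk}^n=\sum_{l=1}^L\mathbf{R}_{lk}^{jn}+\tfrac{1}{\rho_{\mathrm{tr}}}\mathbf{I}_M,$$ and $\mathbf{W}_{jk}^n=\mathbf{R}_{jk}^{jn}(\mathbf{Q}_{jk}^n)^{-1}$ is the MMSE estimation matrix. Define $$\chi_{jk}^n=\mathrm{tr}(\mathbf{W}_{jk}^n\mathbf{R}_{jk}^{jn}),\qquad \zeta_{jk}^{lin}=\mathrm{tr}\left(\mathbf{W}_{li}^n\mathbf{Q}_{li}^n(\mathbf{W}_{li}^n)^{\mathrm H}\mathbf{R}_{jk}^{ln}\right),\qquad \xi_{jk}^{ln}=\mathrm{tr}(\mathbf{W}_{lk}^n\mathbf{R}_{jk}^{ln}).$$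 $\|\cdot\|$ is the $\ell_2$ norm, $(\cdot)^{\mathrm H}$ the Hermitian transpose, $(\cdot)^T$ the transpose, and $\mathrm{tr}$ the matrix trace. The left-hand side of the first constraint of the epigraph problem is the effective downlink SINR of user $k$ of cell $j$ under maximum ratio transmission with MMSE channel estimates.
   Formalization: Convexity is for each fixed γ and the ϱ are taken nonnegative; feasible points satisfy the SINR constraints, but the converse is proved only when, for all j,k and l≠j, the ξ_{jk}^{ln} lie on one ray over n, with each cell counted once in x̄ (or K=1). *)

theory Defs
  imports "HOL-Analysis.Analysis"
begin

text \<open>
  Index types: \<open>'l\<close> cells, \<open>'k\<close> users of a cell, \<open>'n\<close> sub-arrays of a cell, \<open>'m\<close> antennas of a
  sub-array; thus L, K, N, M are the cardinalities of these (nonempty, finite) types.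
  \<open>R j k l n\<close> is the covariance matrix of the channel between user k of cell j and sub-array n of
  cell l.  A family of power control coefficients is a vector \<open>\<nu>\<close> with \<open>\<nu> $ l $ i $ n\<close> belonging to
  sub-array n of cell l and user i of cell l; \<open>\<rho>\<close> is the normalized pilot power, \<open>s2\<close> the noise
  variance.
\<close>

type_synonym ('l, 'k, 'n, 'm) covariances = "'l \<Rightarrow> 'k \<Rightarrow> 'l \<Rightarrow> 'n \<Rightarrow> complex^'m^'m"
type_synonym ('l, 'k, 'n) coeffs = "real^'n^'k^'l"
type_synonym ('l, 'k, 'n, 'a) auxiliaries = "'a^'n^'l^'k^'l"

definition herm :: "complex^'a^'b \<Rightarrow> complex^'b^'a" where
  "herm A = (\<chi> i j. cnj (A $ j $ i))"

definition hermitian_psd :: "complex^'m^'m \<Rightarrow> bool" where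
  "hermitian_psd A \<longleftrightarrow> herm A = A \<and> (\<forall>v. 0 \<le> Re (\<Sum>i\<in>UNIV. cnj (v $ i) * (A *v v) $ i))"

definition Qmat :: "('l::finite, 'k, 'n, 'm) covariances \<Rightarrow> real \<Rightarrow> 'l \<Rightarrow> 'k \<Rightarrow> 'n \<Rightarrow> complex^'m^'m"
  where "Qmat R \<rho> j k n = (\<Sum>l\<in>UNIV. R l k j n) + (1 / \<rho>) *\<^sub>R mat 1"

definition Wmat ::
    "('l::finite, 'k, 'n, 'm::finite) covariances \<Rightarrow> real \<Rightarrow> 'l \<Rightarrow> 'k \<Rightarrow> 'n \<Rightarrow> complex^'m^'m"
  where "Wmat R \<rho> j k n = R j k j n ** matrix_inv (Qmat R \<rho> j k n)"

definition chi_coeff ::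
    "('l::finite, 'k, 'n, 'm::finite) covariances \<Rightarrow> real \<Rightarrow> 'l \<Rightarrow> 'k \<Rightarrow> 'n \<Rightarrow> complex"
  where "chi_coeff R \<rho> j k n = trace (Wmat R \<rho> j k n ** R j k j n)"

text \<open>
  For Hermitian positive semidefinite covariances and \<open>\<rho> > 0\<close>, the matrix \<open>W Q W\<^sup>H\<close> is again Hermitian
  positive semidefinite, so \<open>power_coeff\<close> and \<open>zeta_coeff\<close> are traces of, respectively, a positive
  semidefinite matrix and a product of two such matrices.  Both traces are therefore real and
  nonnegative, and taking the real part only adjusts the type.  In contrast, \<open>xi_coeff\<close> below is in
  general a complex number.
\<close>

definition zeta_coeff ::
    "('l::finite, 'k, 'n, 'm::finite) covariances \<Rightarrow> real \<Rightarrow> 'l \<Rightarrow> 'k \<Rightarrow> 'l \<Rightarrow> 'k \<Rightarrow> 'n \<Rightarrow> real"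
  where "zeta_coeff R \<rho> j k l i n =
    Re (trace (Wmat R \<rho> l i n ** Qmat R \<rho> l i n ** herm (Wmat R \<rho> l i n) ** R j k l n))"

definition xi_coeff ::
    "('l::finite, 'k, 'n, 'm::finite) covariances \<Rightarrow> real \<Rightarrow> 'l \<Rightarrow> 'k \<Rightarrow> 'l \<Rightarrow> 'n \<Rightarrow> complex"
  where "xi_coeff R \<rho> j k l n = trace (Wmat R \<rho> l k n ** R j k l n)"

definition power_coeff ::
    "('l::finite, 'k, 'n, 'm::finite) covariances \<Rightarrow> real \<Rightarrow> 'l \<Rightarrow> 'k \<Rightarrow> 'n \<Rightarrow> real"
  where "power_coeff R \<rho> l i n =
    Re (trace (Wmat R \<rho> l i n ** Qmat R \<rho> l i n ** herm (Wmat R \<rho> l i n)))"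

definition signal ::
    "('l::finite, 'k::finite, 'n::finite, 'm::finite) covariances \<Rightarrow> real
      \<Rightarrow> ('l, 'k, 'n) coeffs \<Rightarrow> 'l \<Rightarrow> 'k \<Rightarrow> real"
  where "signal R \<rho> \<nu> j k =
    cmod (\<Sum>n\<in>UNIV. complex_of_real (\<nu> $ j $ k $ n) * chi_coeff R \<rho> j k n)"

definition sinr ::
    "('l::finite, 'k::finite, 'n::finite, 'm::finite) covariances \<Rightarrow> real \<Rightarrow> real
      \<Rightarrow> ('l, 'k, 'n) coeffs \<Rightarrow> 'l \<Rightarrow> 'k \<Rightarrow> real"
  where "sinr R \<rho> s2 \<nu> j k =
    (signal R \<rho> \<nu> j k)\<^sup>2 /
    ((\<Sum>l\<in>UNIV. \<Sum>i\<in>UNIV. \<Sum>n\<in>UNIV. (\<nu> $ l $ i $ n)\<^sup>2 * zeta_coeff R \<rho> j k l i n)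
     + (\<Sum>l\<in>UNIV - {j}.
         (cmod (\<Sum>n\<in>UNIV. complex_of_real (\<nu> $ l $ k $ n) * xi_coeff R \<rho> j k l n))\<^sup>2)
     + s2)"

definition power_set ::
    "('l::finite, 'k::finite, 'n::finite, 'm::finite) covariances \<Rightarrow> real
      \<Rightarrow> ('l, 'k, 'n) coeffs set"
  where "power_set R \<rho> =
    {\<nu>. (\<forall>l. (\<Sum>i\<in>UNIV. \<Sum>n\<in>UNIV. (\<nu> $ l $ i $ n)\<^sup>2 * power_coeff R \<rho> l i n) \<le> 1)
      \<and> (\<forall>l i n. 0 \<le> \<nu> $ l $ i $ n)}"

definition epigraph_set ::
    "('l::finite, 'k::finite, 'n::finite, 'm::finite) covariances \<Rightarrow> real \<Rightarrow> real
      \<Rightarrow> (('l, 'k, 'n) coeffs \<times> real) set"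
  where "epigraph_set R \<rho> s2 =
    {(\<nu>, \<gamma>). (\<forall>j k. sinr R \<rho> s2 \<nu> j k \<ge> \<gamma>) \<and> \<nu> \<in> power_set R \<rho>}"

definition min_sinr ::
    "('l::finite, 'k::finite, 'n::finite, 'm::finite) covariances \<Rightarrow> real \<Rightarrow> real
      \<Rightarrow> ('l, 'k, 'n) coeffs \<Rightarrow> real"
  where "min_sinr R \<rho> s2 \<nu> = Min {sinr R \<rho> s2 \<nu> j k | j k. True}"

definition quasiconcave_on :: "'a::real_vector set \<Rightarrow> ('a \<Rightarrow> real) \<Rightarrow> bool" where
  "quasiconcave_on S f \<longleftrightarrow> convex S \<and>
    (\<forall>x\<in>S. \<forall>y\<in>S. \<forall>u\<ge>0. \<forall>v\<ge>0. u + v = 1 \<longrightarrow> min (f x) (f y) \<le> f (u *\<^sub>R x + v *\<^sub>R y))"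

text \<open>
  The auxiliary variable attached to j, k, l, n (upper index triple l, k, n) is \<open>\<rho>x $ j $ k $ l $ n\<close>.
  The norm of the product type and of nested vectors is the \<open>\<ell>\<^sub>2\<close> norm of the concatenation.
\<close>

definition x_tilde ::
    "('l::finite, 'k::finite, 'n::finite, 'm::finite) covariances \<Rightarrow> real \<Rightarrow> 'l \<Rightarrow> 'k
      \<Rightarrow> ('l, 'k, 'n) coeffs \<Rightarrow> real^'n^'k^'l"
  where "x_tilde R \<rho> j k \<nu> = (\<chi> l i n. \<nu> $ l $ i $ n * sqrt (zeta_coeff R \<rho> j k l i n))"

definition x_bar ::
    "'l \<Rightarrow> 'k \<Rightarrow> ('l::finite, 'k::finite, 'n::finite, 'a::real_normed_vector) auxiliaries \<Rightarrow> 'a^'k^'l"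
  where "x_bar j k \<rho>x = (\<chi> l i. if l \<noteq> j then (\<Sum>n\<in>UNIV. \<rho>x $ j $ k $ l $ n) else 0)"

text \<open>
  The entries of \<open>x_bar\<close> do not depend on i, so every interfering cell is counted K times in its
  squared norm, although it occurs once in the denominator of the SINR.  The variant \<open>x_bar_once\<close>
  keeps only the entry of the user i = k to which the auxiliary variables belong.
\<close>

definition x_bar_once ::
    "'l \<Rightarrow> 'k \<Rightarrow> ('l::finite, 'k::finite, 'n::finite, 'a::real_normed_vector) auxiliaries \<Rightarrow> 'a^'k^'l"
  where "x_bar_once j k \<rho>x =
    (\<chi> l i. if l \<noteq> j \<and> i = k then (\<Sum>n\<in>UNIV. \<rho>x $ j $ k $ l $ n) else 0)"

definition exact_aux ::
    "('l::finite, 'k::finite, 'n::finite, 'm::finite) covariances \<Rightarrow> real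
      \<Rightarrow> ('l, 'k, 'n) coeffs \<Rightarrow> ('l, 'k, 'n, complex) auxiliaries"
  where "exact_aux R \<rho> \<nu> = (\<chi> j k l n. complex_of_real (\<nu> $ l $ k $ n) * xi_coeff R \<rho> j k l n)"

text \<open>
  The argument \<open>xb\<close> is \<open>x_bar\<close> or \<open>x_bar_once\<close>.  The auxiliary variables are nonnegative: for
  variables of arbitrary sign the constraint set would not be convex, and terms belonging to different
  sub-arrays could cancel.
\<close>

definition feasibility_set ::
    "('l \<Rightarrow> 'k \<Rightarrow> ('l, 'k, 'n, real) auxiliaries \<Rightarrow> real^'k^'l)
      \<Rightarrow> ('l::finite, 'k::finite, 'n::finite, 'm::finite) covariances \<Rightarrow> real \<Rightarrow> real \<Rightarrow> real
      \<Rightarrow> (('l, 'k, 'n) coeffs \<times> ('l, 'k, 'n, real) auxiliaries) set"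
  where "feasibility_set xb R \<rho> s2 \<gamma> =
    {(\<nu>, \<rho>x).
      (\<forall>j k. norm (x_tilde R \<rho> j k \<nu>, xb j k \<rho>x, sqrt s2) \<le> 1 / sqrt \<gamma> * signal R \<rho> \<nu> j k)
      \<and> \<nu> \<in> power_set R \<rho>
      \<and> (\<forall>j k l n. (cmod (complex_of_real (\<nu> $ l $ k $ n) * xi_coeff R \<rho> j k l n))\<^sup>2
                     \<le> (\<rho>x $ j $ k $ l $ n)\<^sup>2
                   \<and> 0 \<le> \<rho>x $ j $ k $ l $ n)}"

text \<open>
  For fixed j, k and l, the numbers \<open>xi_coeff R \<rho> j k l n\<close> lie on a common ray from the origin
  (for instance, they are all real and nonnegative).
\<close>

definition aligned_xi ::
    "('l::finite, 'k, 'n, 'm::finite) covariances \<Rightarrow> real \<Rightarrow> bool"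
  where "aligned_xi R \<rho> \<longleftrightarrow>
    (\<forall>j k l. l \<noteq> j \<longrightarrow> (\<exists>u. \<forall>n. \<exists>r\<ge>0. xi_coeff R \<rho> j k l n = complex_of_real r * u))"

end

theory Submission
  imports Defs
begin

text \<open>
  All \<open>\<chi>\<close>, \<open>\<zeta>\<close> and power coefficients are traces of a positive semidefinite matrix or of a product
  of two such matrices, hence real and nonnegative.  So for nonnegative power coefficients the signal
  is linear in \<open>\<nu>\<close>, and the denominator of the SINR is the squared norm of a vector affine in \<open>\<nu>\<close>.
  For \<open>\<gamma> > 0\<close> the SINR constraint is therefore a second-order cone constraint; for \<open>\<gamma> \<le> 0\<close> it is
  void.  Replacing the interference sums by sums of auxiliary variables only increases the norm, and
  keeps it when the terms of each sum are aligned.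
\<close>

section \<open>Hermitian positive semidefinite matrices\<close>

lemma matrix_vector_mult_axis:
  fixes A :: "complex^'n^'m"
  shows "A *v axis k 1 = column k A"
  by (simp add: matrix_vector_mult_def axis_def column_def vec_eq_iff if_distrib cong: if_cong)

lemma scaleR_matrix_vector_mult:
  fixes A :: "complex^'n^'m"
  shows "(c *\<^sub>R A) *v v = c *\<^sub>R (A *v v)"
  by (simp add: matrix_vector_mult_def vec_eq_iff scaleR_sum_right)

text \<open>Conjugate-linear in the first argument, so that \<open>cdot v (A *v v)\<close> is the
  quadratic form in \<open>hermitian_psd_def\<close>.\<close>

definition cdot :: "complex^'a \<Rightarrow> complex^'a \<Rightarrow> complex" where
  "cdot v w = (\<Sum>i\<in>UNIV. cnj (v $ i) * w $ i)"

lemma cdot_add_left: "cdot (u + v) w = cdot u w + cdot v w"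
  by (simp add: cdot_def distrib_right sum.distrib)

lemma cdot_add_right: "cdot u (v + w) = cdot u v + cdot u w"
  by (simp add: cdot_def distrib_left sum.distrib)

lemma cdot_diff_right: "cdot u (v - w) = cdot u v - cdot u w"
  by (simp add: cdot_def right_diff_distrib sum_subtractf)

lemma cdot_scale_left: "cdot (a *s v) w = cnj a * cdot v w"
  by (simp add: cdot_def sum_distrib_left mult.assoc)

lemma cdot_scale_right: "cdot v (a *s w) = a * cdot v w"
  by (simp add: cdot_def sum_distrib_left mult_ac)

lemma cdot_scaleR_right: "cdot v (c *\<^sub>R w) = c *\<^sub>R cdot v w"
  by (simp add: cdot_def scaleR_sum_right)

lemma cnj_cdot: "cnj (cdot v w) = cdot w v"
  by (simp add: cdot_def mult.commute)

lemma cdot_axis: "cdot (axis i 1) v = v $ i"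
proof -
  have "cnj ((axis i 1 :: complex^'a) $ k) * v $ k = (if k = i then v $ k else 0)" for k
    by (simp add: axis_def)
  then show ?thesis by (simp add: cdot_def)
qed

lemma cdot_self: "cdot v v = complex_of_real ((norm v)\<^sup>2)"
  by (simp add: cdot_def norm_vec_def L2_set_def sum_nonneg complex_norm_square mult.commute
      del: of_real_power)

lemma cdot_herm:
  fixes A :: "complex^'a^'b"
  shows "cdot v (A *v w) = cdot (herm A *v v) w"
  unfolding cdot_def matrix_vector_mult_def herm_def
  by (simp add: sum_distrib_left sum_distrib_right mult_ac) (rule sum.swap)

lemma herm_herm [simp]: "herm (herm A) = A"
  by (simp add: herm_def vec_eq_iff)

lemma herm_entry: "herm A $ i $ j = cnj (A $ j $ i)"
  by (simp add: herm_def)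

lemma herm_eq_entry: "herm A = A \<Longrightarrow> cnj (A $ i $ j) = A $ j $ i"
  by (metis herm_entry)

lemma herm_mat_1 [simp]: "herm (mat 1) = mat 1"
  by (auto simp: herm_def mat_def vec_eq_iff)

lemma herm_add: "herm (A + B) = herm A + herm B"
  by (simp add: herm_def vec_eq_iff)

lemma herm_diff: "herm (A - B) = herm A - herm B"
  by (simp add: herm_def vec_eq_iff)

lemma herm_scaleR: "herm (c *\<^sub>R A) = c *\<^sub>R herm A"
  by (simp add: herm_def vec_eq_iff)

lemma herm_mult: "herm (A ** B) = herm B ** herm A"
  by (simp add: herm_def matrix_matrix_mult_def vec_eq_iff mult.commute)

section \<open>Closure properties of positive semidefinite matrices\<close>

lemma hermitian_psd_cdot:
  "hermitian_psd A \<longleftrightarrow> herm A = A \<and> (\<forall>v. 0 \<le> Re (cdot v (A *v v)))"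
  by (simp add: hermitian_psd_def cdot_def)

lemma hermitian_psd_add: "hermitian_psd A \<Longrightarrow> hermitian_psd B \<Longrightarrow> hermitian_psd (A + B)"
  by (simp add: hermitian_psd_cdot herm_add matrix_vector_mult_add_rdistrib cdot_add_right)

lemma hermitian_psd_zero: "hermitian_psd 0"
  by (simp add: hermitian_psd_cdot herm_def vec_eq_iff matrix_vector_mult_def cdot_def)

lemma hermitian_psd_sum:
  "(\<And>x. x \<in> S \<Longrightarrow> hermitian_psd (f x)) \<Longrightarrow> hermitian_psd (\<Sum>x\<in>S. f x)"
  by (induction S rule: infinite_finite_induct) (auto simp: hermitian_psd_zero hermitian_psd_add)

lemma hermitian_psd_scaleR_mat:
  assumes "c \<ge> 0" shows "hermitian_psd (c *\<^sub>R mat 1)"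
  using assms by (simp add: hermitian_psd_cdot herm_scaleR scaleR_matrix_vector_mult
      cdot_scaleR_right cdot_self)

text \<open>The quadratic form of the product at \<open>v\<close> is that of \<open>A\<close> at
  \<open>herm X *v v\<close>.\<close>

lemma hermitian_psd_conj:
  fixes X :: "complex^'a^'b"
  assumes "hermitian_psd A" shows "hermitian_psd (X ** A ** herm X)"
proof -
  have "cdot v ((X ** A ** herm X) *v v) = cdot (herm X *v v) (A *v (herm X *v v))" for v
    by (metis cdot_herm matrix_vector_mul_assoc)
  then show ?thesis
    using assms by (simp add: hermitian_psd_cdot herm_mult matrix_mul_assoc)
qed

text \<open>The substitution w = Q^-1 v turns the quadratic form of the inverse at v into that of Q
  at w.\<close>

lemma hermitian_psd_matrix_inv:
  fixes Q :: "complex^'m^'m"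
  assumes Q: "hermitian_psd Q" and inv: "invertible Q"
  shows "hermitian_psd (matrix_inv Q)"
proof -
  let ?I = "matrix_inv Q"
  have I: "Q ** ?I = mat 1" "?I ** Q = mat 1"
    using inv unfolding invertible_def matrix_inv_def by (metis (mono_tags, lifting) someI_ex)+
  have hQ: "herm Q = Q" using Q by (simp add: hermitian_psd_cdot)
  \<comment> \<open>Taking adjoints makes \<open>herm ?I\<close> a left inverse of the Hermitian
    \<open>Q\<close>, and a left inverse agrees with the right inverse \<open>?I\<close>.\<close>
  have "herm ?I ** Q = mat 1"
    using I(1) hQ by (metis herm_mult herm_mat_1)
  then have "herm ?I = ?I"
    using I by (metis matrix_mul_assoc matrix_mul_lid matrix_mul_rid)
  moreover have "cdot v (?I *v v) = cdot (?I *v v) (Q *v (?I *v v))" for v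
  proof -
    have "Q *v (?I *v v) = v" using I by (simp add: matrix_vector_mul_assoc)
    then show ?thesis using cdot_herm[of "?I *v v" Q "?I *v v"] hQ by simp
  qed
  ultimately show ?thesis using Q by (simp add: hermitian_psd_cdot)
qed

text \<open>On a kernel vector \<open>v\<close> the quadratic form vanishes, yet it is at least
  \<open>c\<close> times the squared norm of \<open>v\<close>. So the kernel is trivial, which
  suffices for a square matrix.\<close>

lemma invertible_psd_plus_scalar:
  fixes A :: "complex^'m^'m"
  assumes "hermitian_psd A" "c > 0"
  shows "invertible (A + c *\<^sub>R mat 1)"
proof -
  have "v = 0" if "(A + c *\<^sub>R mat 1) *v v = 0" for v :: "complex^'m"
  proof -
    have "0 = Re (cdot v ((A + c *\<^sub>R mat 1) *v v))"
      unfolding that by (simp add: cdot_def)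
    also have "\<dots> = Re (cdot v (A *v v)) + c * (norm v)\<^sup>2"
      by (simp add: matrix_vector_mult_add_rdistrib scaleR_matrix_vector_mult
          cdot_add_right cdot_scaleR_right cdot_self)
    finally have "c * (norm v)\<^sup>2 \<le> 0"
      using assms by (smt (verit) hermitian_psd_cdot)
    then show ?thesis using \<open>c > 0\<close> by (simp add: mult_le_0_iff)
  qed
  then show ?thesis
    unfolding invertible_left_inverse matrix_left_invertible_ker by blast
qed

section \<open>Traces of positive semidefinite matrices and of their products\<close>

lemma hermitian_psd_diag:
  fixes A :: "complex^'m^'m"
  assumes "hermitian_psd A"
  shows "A $ i $ i = of_real (Re (A $ i $ i))" "0 \<le> Re (A $ i $ i)"
proof -
  have "cnj (A $ i $ i) = A $ i $ i"
    using assms herm_eq_entry[of A] by (simp add: hermitian_psd_def)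
  then show "A $ i $ i = of_real (Re (A $ i $ i))"
    by (metis Reals_cnj_iff of_real_Re)
  have "cdot (axis i 1) (A *v axis i 1) = A $ i $ i"
    by (simp add: cdot_axis matrix_vector_mult_axis column_def)
  then show "0 \<le> Re (A $ i $ i)"
    using assms by (metis hermitian_psd_cdot)
qed

lemma hermitian_psd_trace:
  fixes A :: "complex^'m^'m"
  assumes "hermitian_psd A"
  shows "trace A = of_real (Re (trace A))" "0 \<le> Re (trace A)"
proof -
  have "trace A = (\<Sum>i\<in>UNIV. of_real (Re (A $ i $ i)))"
    unfolding trace_def by (rule sum.cong[OF refl hermitian_psd_diag(1)[OF assms]])
  then show "trace A = of_real (Re (trace A))" by simp
  show "0 \<le> Re (trace A)"
    unfolding trace_def Re_sum by (intro sum_nonneg hermitian_psd_diag(2)[OF assms])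
qed

text \<open>A quadratic polynomial in the shift \<open>a\<close>. Large shifts force a row with zero
  diagonal entry to vanish; minimising over \<open>a\<close> yields the Schur complement.\<close>

lemma cdot_hermitian_shift:
  fixes B :: "complex^'m^'m"
  assumes "herm B = B"
  shows "cdot (v + a *s axis i 1) (B *v (v + a *s axis i 1)) =
    cdot v (B *v v) + cnj a * (B *v v) $ i + a * cnj ((B *v v) $ i) + cnj a * a * B $ i $ i"
proof -
  have "cdot v (B *v axis i 1) = cnj ((B *v v) $ i)"
    by (metis assms cdot_axis cdot_herm cnj_cdot)
  moreover have "cdot (axis i 1) (B *v axis i 1) = B $ i $ i"
    by (simp add: cdot_axis matrix_vector_mult_axis column_def)
  ultimately show ?thesis
    by (simp add: vec.add vec.scale cdot_add_left cdot_add_right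
        cdot_scale_left cdot_scale_right cdot_axis algebra_simps)
qed

text \<open>With a zero diagonal entry the form is affine along the shifts \<open>- s * c\<close>,
  where \<open>c\<close> is the entry in question. Being bounded below for all real
  \<open>s\<close>, it has slope zero, and the slope is -2 times the squared modulus of
  \<open>c\<close>.\<close>

lemma hermitian_psd_zero_diag_row:
  fixes B :: "complex^'m^'m"
  assumes B: "hermitian_psd B" and "B $ i $ i = 0"
  shows "B $ i $ j = 0"
proof -
  define v :: "complex^'m" where "v = axis j 1"
  define c where "c = (B *v v) $ i"
  have "0 \<le> Re (cdot v (B *v v)) - 2 * s * (cmod c)\<^sup>2" for s
  proof -
    have "cdot (v + (- of_real s * c) *s axis i 1) (B *v (v + (- of_real s * c) *s axis i 1))
        = cdot v (B *v v) - 2 * of_real s * (c * cnj c)"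
      using assms by (subst cdot_hermitian_shift) (auto simp: hermitian_psd_cdot c_def algebra_simps)
    also have "c * cnj c = of_real ((cmod c)\<^sup>2)"
      by (rule complex_norm_square[symmetric])
    finally have "Re (cdot (v + (- of_real s * c) *s axis i 1) (B *v (v + (- of_real s * c) *s axis i 1)))
        = Re (cdot v (B *v v)) - 2 * s * (cmod c)\<^sup>2" by simp
    then show ?thesis using B by (metis hermitian_psd_cdot)
  qed
  \<comment> \<open>For nonzero \<open>c\<close> this choice of \<open>s\<close> would give the form
    the value -1.\<close>
  from this[of "(Re (cdot v (B *v v)) + 1) / (2 * (cmod c)\<^sup>2)"] have "c = 0"
    by (cases "c = 0") (auto simp: field_simps)
  then show ?thesis
    by (simp add: c_def v_def matrix_vector_mult_axis column_def)
qed

definition outer :: "complex^'a \<Rightarrow> complex^'a^'a" where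
  "outer b = (\<chi> x y. b $ x * cnj (b $ y))"

lemma outer_mult_vec: "outer b *v v = cdot b v *s b"
  by (simp add: outer_def matrix_vector_mult_def cdot_def vec_eq_iff sum_distrib_left mult_ac)

lemma herm_outer: "herm (outer b) = outer b"
  by (simp add: outer_def herm_def vec_eq_iff mult.commute)

lemma trace_mult_outer: "trace (A ** outer b) = cdot b (A *v b)"
  by (simp add: trace_def matrix_matrix_mult_def outer_def cdot_def matrix_vector_mult_def
      sum_distrib_left mult_ac)

text \<open>This is the Schur complement of the pivot \<open>d\<close>: its form at \<open>v\<close>
  is the minimum over \<open>a\<close> of the form of \<open>B\<close> at
  \<open>v + a *s axis i 1\<close>, hence nonnegative.\<close>

lemma hermitian_psd_eliminate:
  fixes B :: "complex^'m^'m"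
  assumes B: "hermitian_psd B" and d: "B $ i $ i = of_real d" "d > 0"
  shows "hermitian_psd (B - (1 / d) *\<^sub>R outer (column i B))"
proof -
  let ?b = "column i B"
  let ?B' = "B - (1 / d) *\<^sub>R outer ?b"
  have hB: "herm B = B" using B by (simp add: hermitian_psd_cdot)
  have "0 \<le> Re (cdot v (?B' *v v))" for v
  proof -
    define c where "c = (B *v v) $ i"
    \<comment> \<open>The minimiser along axis \<open>i\<close>, found by completing the
      square.\<close>
    define a where "a = - c / of_real d"
    have bv: "cdot ?b v = c"
      by (metis c_def cdot_axis cdot_herm hB matrix_vector_mult_axis)
    then have vb: "cdot v ?b = cnj c" by (metis cnj_cdot)
    have "?B' *v v = B *v v - (1 / d) *\<^sub>R (c *s ?b)"
      by (simp add: matrix_vector_mult_diff_rdistrib scaleR_matrix_vector_mult outer_mult_vec bv)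
    then have "cdot v (?B' *v v) = cdot v (B *v v) - (1 / d) *\<^sub>R (c * cnj c)"
      by (simp add: cdot_diff_right cdot_scaleR_right cdot_scale_right vb)
    also have "\<dots> = cdot v (B *v v) + cnj a * c + a * cnj c + cnj a * a * of_real d"
      using d(2) by (simp add: a_def scaleR_conv_of_real field_simps)
    also have "\<dots> = cdot (v + a *s axis i 1) (B *v (v + a *s axis i 1))"
      by (simp only: cdot_hermitian_shift[OF hB] c_def d(1))
    finally show ?thesis using B by (metis hermitian_psd_cdot)
  qed
  then show ?thesis
    by (simp add: hermitian_psd_cdot herm_diff herm_scaleR herm_outer hB)
qed

text \<open>
  The induction splits rank-one matrices off \<open>B\<close>, one Cholesky step per index, so no spectral theorem
  is needed.
\<close>

lemma hermitian_psd_trace_mult_nonneg: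
  fixes A B :: "complex^'m^'m"
  assumes A: "hermitian_psd A" and "hermitian_psd B"
  shows "0 \<le> Re (trace (A ** B))"
proof -
  \<comment> \<open>The set \<open>S\<close> contains the index of every nonzero row of
    \<open>B\<close>. Each elimination removes one index, while \<open>A\<close> stays
    fixed.\<close>
  have "0 \<le> Re (trace (A ** B))"
    if "hermitian_psd B" "\<And>x y. x \<notin> S \<Longrightarrow> B $ x $ y = 0" "finite S" for S and B :: "complex^'m^'m"
    using that(3,1,2)
  proof (induction S arbitrary: B rule: finite_induct)
    case empty
    then have "B = 0" by (simp add: vec_eq_iff)
    then show ?case by (simp add: trace_def matrix_matrix_mult_def)
  next
    case (insert i S)
    define d where "d = Re (B $ i $ i)"
    have d: "B $ i $ i = of_real d" "0 \<le> d"
      using hermitian_psd_diag[OF insert.prems(1), of i] by (simp_all add: d_def)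
    show ?case
    proof (cases "d = 0")
      case True
      \<comment> \<open>A zero pivot makes row \<open>i\<close> vanish, so the nonzero rows already
        lie in \<open>S\<close>.\<close>
      then have "B $ i $ y = 0" for y
        using hermitian_psd_zero_diag_row[OF insert.prems(1)] d by simp
      then show ?thesis using insert by (metis insert_iff)
    next
      case False
      then have "d > 0" using d by simp
      let ?b = "column i B"
      let ?B' = "B - (1 / d) *\<^sub>R outer ?b"
      have psd: "hermitian_psd ?B'"
        by (rule hermitian_psd_eliminate) (use insert.prems d \<open>d > 0\<close> in auto)
      have "cnj (B $ y $ i) = B $ i $ y" for y
        using insert.prems(1) herm_eq_entry[of B] by (simp add: hermitian_psd_def)
      \<comment> \<open>Row \<open>i\<close> cancels against the rank-one term. Any other row
        outside \<open>S\<close> is zero in \<open>B\<close>, including its entry in column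
        \<open>i\<close>, so the rank-one term is zero there too.\<close>
      then have "?B' $ x $ y = 0" if "x \<notin> S" for x y
        using that insert.prems(2)[of x] d \<open>d > 0\<close>
        by (cases "x = i") (auto simp: outer_def column_def scaleR_conv_of_real[where 'a=complex])
      then have "0 \<le> Re (trace (A ** ?B'))"
        by (rule insert.IH[OF psd])
      moreover have "trace (A ** B) = trace (A ** ?B') + (1 / d) *\<^sub>R trace (A ** outer ?b)"
      proof -
        have "A ** B = A ** ?B' + (1 / d) *\<^sub>R (A ** outer ?b)"
          by (simp add: matrix_matrix_mult_def vec_eq_iff right_diff_distrib sum_subtractf scaleR_sum_right)
        then show ?thesis by (simp add: trace_def sum.distrib scaleR_sum_right)
      qed
      moreover have "0 \<le> Re (trace (A ** outer ?b))"
        using A by (simp add: trace_mult_outer hermitian_psd_cdot)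
      ultimately show ?thesis using \<open>d > 0\<close> by simp
    qed
  qed
  from this[of B UNIV] show ?thesis using assms by simp
qed

section \<open>The power control problem\<close>

lemma norm_vec_power2: "(norm x)\<^sup>2 = (\<Sum>i\<in>UNIV. (norm (x $ i))\<^sup>2)"
  by (simp add: norm_vec_def L2_set_def sum_nonneg)

lemma norm_Pair_power2: "(norm (a, b))\<^sup>2 = (norm a)\<^sup>2 + (norm b)\<^sup>2"
  by (simp add: norm_prod_def)

lemma norm_vec_mono:
  assumes "\<And>i. norm (x $ i) \<le> norm (y $ i)" shows "norm x \<le> norm y"
  unfolding norm_vec_def by (intro L2_set_mono) (auto simp: assms)

lemma norm_middle_mono: "norm b \<le> norm b' \<Longrightarrow> norm (a, b, c) \<le> norm (a, b', c)"
  by (simp add: norm_prod_def power_mono)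

lemma norm_x_bar_once_mono:
  assumes "\<And>l. l \<noteq> j \<Longrightarrow> norm (\<Sum>n\<in>UNIV. p $ j $ k $ l $ n) \<le> norm (\<Sum>n\<in>UNIV. q $ j $ k $ l $ n)"
  shows "norm (x_bar_once j k p) \<le> norm (x_bar_once j k q)"
  by (intro norm_vec_mono) (simp add: x_bar_once_def assms)

lemma norm_x_bar_once_le: "norm (x_bar_once j k p) \<le> norm (x_bar j k p)"
  by (intro norm_vec_mono) (simp add: x_bar_once_def x_bar_def)

lemma x_bar_eq_x_bar_once:
  fixes p :: "('l::finite, 'k::finite, 'n::finite, 'a::real_normed_vector) auxiliaries"
  assumes "CARD('k) = 1"
  shows "x_bar j k p = x_bar_once j k p"
proof -
  have "i = k" for i :: 'k
    using assms by (metis UNIV_I card_1_singletonE singletonD)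
  then show ?thesis by (simp add: x_bar_def x_bar_once_def vec_eq_iff)
qed

lemma x_bar_lin: "x_bar j k (u *\<^sub>R p + v *\<^sub>R q) = u *\<^sub>R x_bar j k p + v *\<^sub>R x_bar j k q"
  by (simp add: x_bar_def vec_eq_iff sum.distrib scaleR_sum_right)

lemma x_bar_once_lin:
  "x_bar_once j k (u *\<^sub>R p + v *\<^sub>R q) = u *\<^sub>R x_bar_once j k p + v *\<^sub>R x_bar_once j k q"
  by (simp add: x_bar_once_def vec_eq_iff sum.distrib scaleR_sum_right)

lemma x_tilde_lin:
  "x_tilde R \<rho> j k (u *\<^sub>R p + v *\<^sub>R q) = u *\<^sub>R x_tilde R \<rho> j k p + v *\<^sub>R x_tilde R \<rho> j k q"
  by (simp add: x_tilde_def vec_eq_iff algebra_simps)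

lemma exact_aux_lin:
  "exact_aux R \<rho> (u *\<^sub>R p + v *\<^sub>R q) = u *\<^sub>R exact_aux R \<rho> p + v *\<^sub>R exact_aux R \<rho> q"
  by (simp add: exact_aux_def vec_eq_iff scaleR_conv_of_real[where 'a=complex] algebra_simps)

section \<open>Elementary convexity inequalities and the smallest SINR\<close>

lemma norm_combination_le:
  assumes "norm x \<le> a" "norm y \<le> b" "0 \<le> u" "0 \<le> v"
  shows "norm (u *\<^sub>R x + v *\<^sub>R y) \<le> u * a + v * b"
proof -
  have "norm (u *\<^sub>R x + v *\<^sub>R y) \<le> u * norm x + v * norm y"
    using norm_triangle_ineq[of "u *\<^sub>R x" "v *\<^sub>R y"] assms by simp
  also have "\<dots> \<le> u * a + v * b"
    using assms by (intro add_mono mult_left_mono)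
  finally show ?thesis .
qed

lemma square_combination_le:
  fixes x y u v :: real
  assumes "0 \<le> u" "0 \<le> v" "u + v = 1"
  shows "(u * x + v * y)\<^sup>2 \<le> u * x\<^sup>2 + v * y\<^sup>2"
proof -
  have v: "v = 1 - u" using assms by simp
  have "u * x\<^sup>2 + v * y\<^sup>2 - (u * x + v * y)\<^sup>2 = u * v * (x - y)\<^sup>2"
    unfolding v by (simp add: power2_eq_square algebra_simps)
  moreover have "0 \<le> u * v * (x - y)\<^sup>2" using assms by simp
  ultimately show ?thesis by linarith
qed

lemma le_min_sinr_iff: "\<gamma> \<le> min_sinr R \<rho> s2 \<nu> \<longleftrightarrow> (\<forall>j k. \<gamma> \<le> sinr R \<rho> s2 \<nu> j k)"
proof -
  \<comment> \<open>The range form exhibits the finiteness and nonemptiness on which the rule for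
    \<open>Min\<close> depends.\<close>
  have "{sinr R \<rho> s2 \<nu> j k | j k. True} = range (\<lambda>(j, k). sinr R \<rho> s2 \<nu> j k)" by auto
  then show ?thesis by (auto simp: min_sinr_def)
qed

section \<open>Real and nonnegative coefficients of the downlink system\<close>

locale downlink_system =
  fixes R :: "('l::finite, 'k::finite, 'n::finite, 'm::finite) covariances"
    and \<rho> s2 :: real
  assumes rho: "\<rho> > 0" and s2: "s2 > 0"
    and R: "\<And>j k l n. hermitian_psd (R j k l n)"
begin

lemma Qmat_psd: "hermitian_psd (Qmat R \<rho> j k n)"
  unfolding Qmat_def using rho R
  by (intro hermitian_psd_add hermitian_psd_sum hermitian_psd_scaleR_mat) auto

text \<open>The multiple of the identity in \<open>Qmat\<close> makes it positive definite, so
  \<open>matrix_inv\<close> denotes a genuine inverse.\<close>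

lemma Qmat_inv_psd: "hermitian_psd (matrix_inv (Qmat R \<rho> j k n))"
proof (rule hermitian_psd_matrix_inv[OF Qmat_psd])
  show "invertible (Qmat R \<rho> j k n)"
    unfolding Qmat_def using rho R by (intro invertible_psd_plus_scalar hermitian_psd_sum) auto
qed

text \<open>Since R is its own adjoint, W R = R Q^-1 R is a congruence of a positive semidefinite
  matrix.\<close>

lemma chi_coeff_real: "chi_coeff R \<rho> j k n = of_real (Re (chi_coeff R \<rho> j k n))"
  and chi_coeff_nonneg: "0 \<le> Re (chi_coeff R \<rho> j k n)"
proof -
  have "herm (R j k j n) = R j k j n" using R by (simp add: hermitian_psd_def)
  then have "hermitian_psd (Wmat R \<rho> j k n ** R j k j n)"
    using hermitian_psd_conj[OF Qmat_inv_psd, where X = "R j k j n"] by (simp add: Wmat_def)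
  then show "chi_coeff R \<rho> j k n = of_real (Re (chi_coeff R \<rho> j k n))"
    "0 \<le> Re (chi_coeff R \<rho> j k n)"
    unfolding chi_coeff_def by (rule hermitian_psd_trace)+
qed

text \<open>The product of W Q W^H with R need not be Hermitian, so the sign comes from the result
  on traces of products.\<close>

lemma zeta_coeff_nonneg: "0 \<le> zeta_coeff R \<rho> j k l i n"
  unfolding zeta_coeff_def
  by (rule hermitian_psd_trace_mult_nonneg[OF hermitian_psd_conj[OF Qmat_psd] R])

lemma power_coeff_nonneg: "0 \<le> power_coeff R \<rho> l i n"
  unfolding power_coeff_def by (rule hermitian_psd_trace(2)[OF hermitian_psd_conj[OF Qmat_psd]])

text \<open>The sum is already a nonnegative real, so the modulus acts as the identity. This makes
  the right-hand side of the cone constraint linear.\<close>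

lemma signal_eq:
  assumes "\<nu> \<in> power_set R \<rho>"
  shows "signal R \<rho> \<nu> j k = (\<Sum>n\<in>UNIV. \<nu> $ j $ k $ n * Re (chi_coeff R \<rho> j k n))"
proof -
  have "(\<Sum>n\<in>UNIV. of_real (\<nu> $ j $ k $ n) * chi_coeff R \<rho> j k n)
      = of_real (\<Sum>n\<in>UNIV. \<nu> $ j $ k $ n * Re (chi_coeff R \<rho> j k n))"
    unfolding of_real_sum of_real_mult chi_coeff_real[symmetric] ..
  moreover have "0 \<le> (\<Sum>n\<in>UNIV. \<nu> $ j $ k $ n * Re (chi_coeff R \<rho> j k n))"
    using assms by (intro sum_nonneg mult_nonneg_nonneg chi_coeff_nonneg) (simp add: power_set_def)
  ultimately show ?thesis by (simp only: signal_def norm_of_real abs_of_nonneg)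
qed

section \<open>Convexity of the power constraints\<close>

lemma convex_power_set: "convex (power_set R \<rho>)"
proof (rule convexI)
  fix x y :: "('l, 'k, 'n) coeffs" and u v :: real
  assume xy: "x \<in> power_set R \<rho>" "y \<in> power_set R \<rho>" and uv: "0 \<le> u" "0 \<le> v" "u + v = 1"
  let ?P = "\<lambda>z l. \<Sum>i\<in>UNIV. \<Sum>n\<in>UNIV. (z $ l $ i $ n)\<^sup>2 * power_coeff R \<rho> l i n"
  have "?P (u *\<^sub>R x + v *\<^sub>R y) l \<le> 1" for l
  proof -
    have "?P (u *\<^sub>R x + v *\<^sub>R y) l \<le>
      (\<Sum>i\<in>UNIV. \<Sum>n\<in>UNIV. (u * (x $ l $ i $ n)\<^sup>2 + v * (y $ l $ i $ n)\<^sup>2) * power_coeff R \<rho> l i n)"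
      using square_combination_le[OF uv]
      by (intro sum_mono mult_right_mono power_coeff_nonneg) simp
    also have "\<dots> = u * ?P x l + v * ?P y l"
      by (simp add: sum.distrib sum_distrib_left distrib_right mult.assoc)
    also have "\<dots> \<le> 1"
      using xy uv by (intro convex_bound_le) (auto simp: power_set_def)
    finally show ?thesis .
  qed
  then show "u *\<^sub>R x + v *\<^sub>R y \<in> power_set R \<rho>"
    using xy uv by (simp add: power_set_def)
qed

section \<open>Second-order cone form of the SINR constraint\<close>

lemma signal_combination:
  assumes "x \<in> power_set R \<rho>" "y \<in> power_set R \<rho>" "0 \<le> u" "0 \<le> v" "u + v = 1"
  shows "signal R \<rho> (u *\<^sub>R x + v *\<^sub>R y) j k = u * signal R \<rho> x j k + v * signal R \<rho> y j k"
  \<comment> \<open>\<open>signal_eq\<close> is also applied at the combined point, which convexity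
    places in \<open>power_set\<close>.\<close>
  using assms convexD[OF convex_power_set assms]
  by (simp add: signal_eq sum.distrib sum_distrib_left distrib_right mult.assoc)

text \<open>Encoded so that the squared norm is the SINR denominator: complex entries keep the
  phases, \<open>x_bar_once\<close> counts each interfering cell once, and the constant noise entry
  makes the map affine in \<open>\<nu>\<close>.\<close>

definition interference ::
    "'l \<Rightarrow> 'k \<Rightarrow> ('l, 'k, 'n) coeffs \<Rightarrow> (real^'n^'k^'l) \<times> (complex^'k^'l) \<times> real" where
  "interference j k \<nu> = (x_tilde R \<rho> j k \<nu>, x_bar_once j k (exact_aux R \<rho> \<nu>), sqrt s2)"

lemma interference_combination:
  assumes "u + v = 1"
  shows "interference j k (u *\<^sub>R x + v *\<^sub>R y) = u *\<^sub>R interference j k x + v *\<^sub>R interference j k y"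
  using assms
  by (simp add: interference_def x_tilde_lin exact_aux_lin x_bar_once_lin flip: distrib_right)

lemma norm_interference:
  "(norm (interference j k \<nu>))\<^sup>2 =
    (\<Sum>l\<in>UNIV. \<Sum>i\<in>UNIV. \<Sum>n\<in>UNIV. (\<nu> $ l $ i $ n)\<^sup>2 * zeta_coeff R \<rho> j k l i n)
     + (\<Sum>l\<in>UNIV - {j}.
         (cmod (\<Sum>n\<in>UNIV. complex_of_real (\<nu> $ l $ k $ n) * xi_coeff R \<rho> j k l n))\<^sup>2)
     + s2"
proof -
  have "(norm (x_tilde R \<rho> j k \<nu>))\<^sup>2 =
      (\<Sum>l\<in>UNIV. \<Sum>i\<in>UNIV. \<Sum>n\<in>UNIV. (\<nu> $ l $ i $ n)\<^sup>2 * zeta_coeff R \<rho> j k l i n)"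
    by (simp add: norm_vec_power2 x_tilde_def power_mult_distrib zeta_coeff_nonneg)
  moreover have "(norm (x_bar_once j k (exact_aux R \<rho> \<nu>)))\<^sup>2 =
      (\<Sum>l\<in>UNIV - {j}.
         (cmod (\<Sum>n\<in>UNIV. complex_of_real (\<nu> $ l $ k $ n) * xi_coeff R \<rho> j k l n))\<^sup>2)"
  proof -
    let ?f = "\<lambda>l. (cmod (\<Sum>n\<in>UNIV. complex_of_real (\<nu> $ l $ k $ n) * xi_coeff R \<rho> j k l n))\<^sup>2"
    have "(norm (x_bar_once j k (exact_aux R \<rho> \<nu>) $ l))\<^sup>2 = (if l \<noteq> j then ?f l else 0)" for l
    proof -
      \<comment> \<open>Among the users of cell \<open>l\<close> only \<open>i = k\<close>
        contributes.\<close>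
      have "(norm (x_bar_once j k (exact_aux R \<rho> \<nu>) $ l))\<^sup>2
          = (\<Sum>i\<in>UNIV. if i = k then (if l \<noteq> j then ?f l else 0) else 0)"
        unfolding norm_vec_power2 by (intro sum.cong) (auto simp: x_bar_once_def exact_aux_def)
      then show ?thesis by simp
    qed
    then have "(norm (x_bar_once j k (exact_aux R \<rho> \<nu>)))\<^sup>2 = (\<Sum>l\<in>UNIV. if l \<noteq> j then ?f l else 0)"
      by (simp add: norm_vec_power2[of "x_bar_once j k (exact_aux R \<rho> \<nu>)"])
    also have "\<dots> = (\<Sum>l\<in>UNIV - {j}. ?f l)"
      by (intro sum.mono_neutral_cong_right) auto
    finally show ?thesis .
  qed
  ultimately show ?thesis
    using s2 by (simp add: interference_def norm_Pair_power2)
qed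

lemma norm_interference_pos: "0 < norm (interference j k \<nu>)"
  using s2 by (simp add: interference_def zero_prod_def)

lemma sinr_eq: "sinr R \<rho> s2 \<nu> j k = (signal R \<rho> \<nu> j k)\<^sup>2 / (norm (interference j k \<nu>))\<^sup>2"
  by (simp only: sinr_def norm_interference)

text \<open>The denominator is positive thanks to the noise entry and can be cleared; taking square
  roots is then reversible because both sides are nonnegative.\<close>

lemma sinr_ge_iff:
  assumes "\<gamma> > 0"
  shows "sinr R \<rho> s2 \<nu> j k \<ge> \<gamma> \<longleftrightarrow>
    norm (interference j k \<nu>) \<le> 1 / sqrt \<gamma> * signal R \<rho> \<nu> j k"
proof -
  have "0 \<le> 1 / sqrt \<gamma> * signal R \<rho> \<nu> j k"
    using assms by (simp add: signal_def)
  then have "norm (interference j k \<nu>) \<le> 1 / sqrt \<gamma> * signal R \<rho> \<nu> j k \<longleftrightarrow>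
      (norm (interference j k \<nu>))\<^sup>2 \<le> (1 / sqrt \<gamma> * signal R \<rho> \<nu> j k)\<^sup>2"
    by (intro power_mono_iff[symmetric]) simp_all
  also have "(1 / sqrt \<gamma> * signal R \<rho> \<nu> j k)\<^sup>2 = (signal R \<rho> \<nu> j k)\<^sup>2 / \<gamma>"
    using assms by (simp add: power_mult_distrib power_divide)
  also have "(norm (interference j k \<nu>))\<^sup>2 \<le> (signal R \<rho> \<nu> j k)\<^sup>2 / \<gamma> \<longleftrightarrow>
      sinr R \<rho> s2 \<nu> j k \<ge> \<gamma>"
    using assms norm_interference_pos[of j k \<nu>]
    by (simp add: sinr_eq pos_le_divide_eq mult.commute)
  finally show ?thesis ..
qed

lemma epigraph_iff:
  assumes "\<gamma> > 0"
  shows "(\<nu>, \<gamma>) \<in> epigraph_set R \<rho> s2 \<longleftrightarrow>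
    (\<forall>j k. norm (interference j k \<nu>) \<le> 1 / sqrt \<gamma> * signal R \<rho> \<nu> j k) \<and> \<nu> \<in> power_set R \<rho>"
  by (simp add: epigraph_set_def sinr_ge_iff[OF assms])

section \<open>Convex level sets and quasi-concavity\<close>

lemma convex_epigraph_level: "convex {\<nu>. (\<nu>, \<gamma>) \<in> epigraph_set R \<rho> s2}"
proof (cases "\<gamma> > 0")
  case True
  show ?thesis
  proof (rule convexI)
    fix x y :: "('l, 'k, 'n) coeffs" and u v :: real
    assume xy: "x \<in> {\<nu>. (\<nu>, \<gamma>) \<in> epigraph_set R \<rho> s2}" "y \<in> {\<nu>. (\<nu>, \<gamma>) \<in> epigraph_set R \<rho> s2}"
      and uv: "0 \<le> u" "0 \<le> v" "u + v = 1"
    have p: "x \<in> power_set R \<rho>" "y \<in> power_set R \<rho>"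
      using xy by (simp_all add: epigraph_iff[OF True])
    have "norm (interference j k (u *\<^sub>R x + v *\<^sub>R y))
        \<le> 1 / sqrt \<gamma> * signal R \<rho> (u *\<^sub>R x + v *\<^sub>R y) j k" for j k
    proof -
      have "norm (interference j k x) \<le> 1 / sqrt \<gamma> * signal R \<rho> x j k"
        "norm (interference j k y) \<le> 1 / sqrt \<gamma> * signal R \<rho> y j k"
        using xy unfolding mem_Collect_eq epigraph_iff[OF True] by blast+
      \<comment> \<open>The triangle inequality handles the affine left side; the linear signal
        turns the combined bound into the bound at the combined point.\<close>
      from norm_combination_le[OF this uv(1,2)] show ?thesis
        by (simp add: interference_combination[OF uv(3)] signal_combination[OF p uv]
            add_divide_distrib)
    qed
    then show "u *\<^sub>R x + v *\<^sub>R y \<in> {\<nu>. (\<nu>, \<gamma>) \<in> epigraph_set R \<rho> s2}"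
      unfolding mem_Collect_eq epigraph_iff[OF True] using convexD[OF convex_power_set p uv] by blast
  qed
next
  case False
  \<comment> \<open>A ratio of squares is nonnegative, so a level \<open>\<gamma> \<le> 0\<close>
    imposes only the power constraints.\<close>
  have "0 \<le> sinr R \<rho> s2 \<nu> j k" for \<nu> j k
    unfolding sinr_eq by simp
  with False have "\<gamma> \<le> sinr R \<rho> s2 \<nu> j k" for \<nu> j k
    by (meson le_cases not_le order_trans)
  then have "{\<nu>. (\<nu>, \<gamma>) \<in> epigraph_set R \<rho> s2} = power_set R \<rho>"
    by (simp add: epigraph_set_def)
  then show ?thesis by (simp add: convex_power_set)
qed

lemma quasiconcave_min_sinr: "quasiconcave_on (power_set R \<rho>) (min_sinr R \<rho> s2)"
  unfolding quasiconcave_on_def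
proof (intro conjI convex_power_set ballI allI impI)
  fix x y u v
  assume xy: "x \<in> power_set R \<rho>" "y \<in> power_set R \<rho>" and uv: "0 \<le> u" "0 \<le> v" "u + v = (1::real)"
  \<comment> \<open>Both points lie in the level set of the smaller value, so convexity of that one
    set suffices.\<close>
  define \<gamma> where "\<gamma> = min (min_sinr R \<rho> s2 x) (min_sinr R \<rho> s2 y)"
  have "(x, \<gamma>) \<in> epigraph_set R \<rho> s2" "(y, \<gamma>) \<in> epigraph_set R \<rho> s2"
    using xy by (simp_all add: epigraph_set_def \<gamma>_def flip: le_min_sinr_iff)
  then have "(u *\<^sub>R x + v *\<^sub>R y, \<gamma>) \<in> epigraph_set R \<rho> s2"
    using convexD[OF convex_epigraph_level[of \<gamma>] _ _ uv, of x y] by simp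
  then show "min (min_sinr R \<rho> s2 x) (min_sinr R \<rho> s2 y) \<le> min_sinr R \<rho> s2 (u *\<^sub>R x + v *\<^sub>R y)"
    by (simp add: epigraph_set_def \<gamma>_def le_min_sinr_iff)
qed

section \<open>The feasibility problem with auxiliary variables\<close>

lemma feasibility_set_iff:
  "(\<nu>, p) \<in> feasibility_set xb R \<rho> s2 \<gamma> \<longleftrightarrow>
    (\<forall>j k. norm (x_tilde R \<rho> j k \<nu>, xb j k p, sqrt s2) \<le> 1 / sqrt \<gamma> * signal R \<rho> \<nu> j k)
    \<and> \<nu> \<in> power_set R \<rho>
    \<and> (\<forall>j k l n. \<nu> $ l $ k $ n * cmod (xi_coeff R \<rho> j k l n) \<le> p $ j $ k $ l $ n)"
proof -
  \<comment> \<open>For nonnegative coefficients the squared bound together with the sign condition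
    becomes one inequality, linear in \<open>\<nu>\<close> and \<open>p\<close> jointly.\<close>
  have "(cmod (of_real (\<nu> $ l $ k $ n) * xi_coeff R \<rho> j k l n))\<^sup>2 \<le> (p $ j $ k $ l $ n)\<^sup>2
        \<and> 0 \<le> p $ j $ k $ l $ n \<longleftrightarrow>
      \<nu> $ l $ k $ n * cmod (xi_coeff R \<rho> j k l n) \<le> p $ j $ k $ l $ n"
    if "\<nu> \<in> power_set R \<rho>" for j k l n
  proof -
    have nn: "0 \<le> \<nu> $ l $ k $ n * cmod (xi_coeff R \<rho> j k l n)"
      and eq: "cmod (of_real (\<nu> $ l $ k $ n) * xi_coeff R \<rho> j k l n) =
        \<nu> $ l $ k $ n * cmod (xi_coeff R \<rho> j k l n)"
      using that by (simp_all add: power_set_def norm_mult)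
    show ?thesis
      unfolding eq using nn power2_le_imp_le power_mono by fastforce
  qed
  then show ?thesis unfolding feasibility_set_def by auto
qed

text \<open>The cone constraint bounds the norm of a jointly affine map by a signal linear on
  \<open>power_set\<close>, and the bounds on the auxiliary variables are linear. The assumption on
  \<open>xb\<close> covers \<open>x_bar\<close> and \<open>x_bar_once\<close> alike.\<close>

lemma convex_feasibility_set:
  assumes lin: "\<And>j k u v p q. xb j k (u *\<^sub>R p + v *\<^sub>R q) = u *\<^sub>R xb j k p + v *\<^sub>R xb j k q"
  shows "convex (feasibility_set xb R \<rho> s2 \<gamma>)"
proof (rule convexI)
  fix a b and u v :: real
  assume ab: "a \<in> feasibility_set xb R \<rho> s2 \<gamma>" "b \<in> feasibility_set xb R \<rho> s2 \<gamma>"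
    and uv: "0 \<le> u" "0 \<le> v" "u + v = 1"
  obtain x p y q where eq: "a = (x, p)" "b = (y, q)" by (meson surj_pair)
  have x: "x \<in> power_set R \<rho>" and y: "y \<in> power_set R \<rho>"
    using ab by (simp_all add: eq feasibility_set_iff)
  have aux: "x $ l $ k $ n * cmod (xi_coeff R \<rho> j k l n) \<le> p $ j $ k $ l $ n"
    "y $ l $ k $ n * cmod (xi_coeff R \<rho> j k l n) \<le> q $ j $ k $ l $ n" for j k l n
    using ab by (simp_all add: eq feasibility_set_iff)
  let ?z = "u *\<^sub>R x + v *\<^sub>R y" and ?r = "u *\<^sub>R p + v *\<^sub>R q"
  have "?z $ l $ k $ n * cmod (xi_coeff R \<rho> j k l n) \<le> ?r $ j $ k $ l $ n" for j k l n
    using add_mono[OF mult_left_mono[OF aux(1) uv(1)] mult_left_mono[OF aux(2) uv(2)]]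
    by (simp add: distrib_right mult.assoc)
  moreover have "norm (x_tilde R \<rho> j k ?z, xb j k ?r, sqrt s2) \<le> 1 / sqrt \<gamma> * signal R \<rho> ?z j k" for j k
  proof -
    have "(x_tilde R \<rho> j k ?z, xb j k ?r, sqrt s2) =
        u *\<^sub>R (x_tilde R \<rho> j k x, xb j k p, sqrt s2) + v *\<^sub>R (x_tilde R \<rho> j k y, xb j k q, sqrt s2)"
      using uv by (simp add: x_tilde_lin lin flip: distrib_right)
    also have "norm \<dots> \<le> u * (1 / sqrt \<gamma> * signal R \<rho> x j k) + v * (1 / sqrt \<gamma> * signal R \<rho> y j k)"
      using ab uv by (intro norm_combination_le) (simp_all add: eq feasibility_set_iff)
    also have "\<dots> = 1 / sqrt \<gamma> * signal R \<rho> ?z j k"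
      by (simp add: signal_combination[OF x y uv] add_divide_distrib)
    finally show ?thesis .
  qed
  ultimately show "u *\<^sub>R a + v *\<^sub>R b \<in> feasibility_set xb R \<rho> s2 \<gamma>"
    using convexD[OF convex_power_set x y uv] by (simp add: eq feasibility_set_iff)
qed

section \<open>Comparison of the feasibility and epigraph problems\<close>

lemma feasible_x_bar_imp_once:
  assumes "(\<nu>, p) \<in> feasibility_set x_bar R \<rho> s2 \<gamma>"
  shows "(\<nu>, p) \<in> feasibility_set x_bar_once R \<rho> s2 \<gamma>"
proof -
  \<comment> \<open>\<open>x_bar\<close> repeats each entry for every user \<open>i\<close>;
    discarding repetitions cannot increase the norm.\<close>
  have "norm (x_tilde R \<rho> j k \<nu>, x_bar_once j k p, sqrt s2)
      \<le> norm (x_tilde R \<rho> j k \<nu>, x_bar j k p, sqrt s2)" for j k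
    by (intro norm_middle_mono norm_x_bar_once_le)
  then show ?thesis
    using assms unfolding feasibility_set_iff by (meson order_trans)
qed

text \<open>By the triangle inequality over the sub-arrays, the sums of auxiliary variables dominate
  the moduli of the true interference sums.\<close>

lemma feasible_imp_epigraph:
  assumes "\<gamma> > 0" and feas: "(\<nu>, p) \<in> feasibility_set x_bar_once R \<rho> s2 \<gamma>"
  shows "(\<nu>, \<gamma>) \<in> epigraph_set R \<rho> s2"
proof -
  have \<nu>: "\<nu> \<in> power_set R \<rho>" using feas by (simp add: feasibility_set_iff)
  have le: "norm (x_bar_once j k (exact_aux R \<rho> \<nu>)) \<le> norm (x_bar_once j k p)" for j k
  proof (rule norm_x_bar_once_mono)
    fix l
    have "norm (\<Sum>n\<in>UNIV. exact_aux R \<rho> \<nu> $ j $ k $ l $ n) \<le> (\<Sum>n\<in>UNIV. p $ j $ k $ l $ n)"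
      using feas \<nu>
      by (intro sum_norm_le) (simp add: exact_aux_def norm_mult feasibility_set_iff power_set_def)
    then show "norm (\<Sum>n\<in>UNIV. exact_aux R \<rho> \<nu> $ j $ k $ l $ n) \<le> norm (\<Sum>n\<in>UNIV. p $ j $ k $ l $ n)"
      by simp
  qed
  have "norm (interference j k \<nu>) \<le> 1 / sqrt \<gamma> * signal R \<rho> \<nu> j k" for j k
    unfolding interference_def using feas[unfolded feasibility_set_iff]
    by (blast intro: order.trans[OF norm_middle_mono[OF le]])
  then show ?thesis using \<nu> by (simp add: epigraph_iff[OF \<open>\<gamma> > 0\<close>])
qed

text \<open>For terms on a common ray the triangle inequality is an equality, so tight auxiliary
  variables reproduce the interference without loss.\<close>

lemma epigraph_imp_feasible:
  assumes "\<gamma> > 0" and epi: "(\<nu>, \<gamma>) \<in> epigraph_set R \<rho> s2" and "aligned_xi R \<rho>"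
  shows "\<exists>p. (\<nu>, p) \<in> feasibility_set x_bar_once R \<rho> s2 \<gamma>"
proof
  \<comment> \<open>The least auxiliary variables that the constraints allow.\<close>
  define p :: "('l, 'k, 'n, real) auxiliaries"
    where "p = (\<chi> j k l n. \<nu> $ l $ k $ n * cmod (xi_coeff R \<rho> j k l n))"
  have \<nu>: "\<nu> \<in> power_set R \<rho>" using epi by (simp add: epigraph_set_def)
  then have nn: "0 \<le> \<nu> $ l $ k $ n" for l k n by (simp add: power_set_def)
  have le: "norm (x_bar_once j k p) \<le> norm (x_bar_once j k (exact_aux R \<rho> \<nu>))" for j k
  proof (rule norm_x_bar_once_mono)
    fix l assume "l \<noteq> j"
    \<comment> \<open>\<open>w\<close> need not have unit length; its modulus is a common factor of
      both sums compared below.\<close>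
    then obtain w where "\<forall>n. \<exists>r\<ge>0. xi_coeff R \<rho> j k l n = complex_of_real r * w"
      using \<open>aligned_xi R \<rho>\<close> unfolding aligned_xi_def by blast
    then obtain r where r: "\<And>n. 0 \<le> r n" "\<And>n. xi_coeff R \<rho> j k l n = complex_of_real (r n) * w"
      by metis
    have nonneg: "0 \<le> (\<Sum>n\<in>UNIV. \<nu> $ l $ k $ n * r n)"
      using nn r(1) by (intro sum_nonneg) simp
    have "(\<Sum>n\<in>UNIV. exact_aux R \<rho> \<nu> $ j $ k $ l $ n) = of_real (\<Sum>n\<in>UNIV. \<nu> $ l $ k $ n * r n) * w"
      by (simp add: exact_aux_def r(2) sum_distrib_right mult.assoc)
    then have "norm (\<Sum>n\<in>UNIV. exact_aux R \<rho> \<nu> $ j $ k $ l $ n) = (\<Sum>n\<in>UNIV. \<nu> $ l $ k $ n * r n) * cmod w"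
      using nonneg by (simp only: norm_mult norm_of_real abs_of_nonneg)
    moreover have "(\<Sum>n\<in>UNIV. p $ j $ k $ l $ n) = (\<Sum>n\<in>UNIV. \<nu> $ l $ k $ n * r n) * cmod w"
      using r(1) by (simp add: p_def r(2) norm_mult sum_distrib_right mult.assoc)
    ultimately show "norm (\<Sum>n\<in>UNIV. p $ j $ k $ l $ n) \<le> norm (\<Sum>n\<in>UNIV. exact_aux R \<rho> \<nu> $ j $ k $ l $ n)"
      using nonneg by simp
  qed
  have "norm (x_tilde R \<rho> j k \<nu>, x_bar_once j k p, sqrt s2) \<le> 1 / sqrt \<gamma> * signal R \<rho> \<nu> j k" for j k
    using epi[unfolded epigraph_iff[OF \<open>\<gamma> > 0\<close>] interference_def]
    by (blast intro: order.trans[OF norm_middle_mono[OF le]])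
  then show "(\<nu>, p) \<in> feasibility_set x_bar_once R \<rho> s2 \<gamma>"
    unfolding feasibility_set_iff using \<nu> by (simp add: p_def)
qed

end

text \<open>Convexity of the SINR constraints is stated at each fixed \<open>\<gamma>\<close>. The
  exact cone form uses the complex interference terms. With real auxiliary variables feasibility is
  in general only sufficient: moduli lose phase cancellation, and \<open>x_bar\<close> counts an
  interfering cell once per user. Alignment removes the first loss; \<open>x_bar_once\<close>, or a
  single user per cell, removes the second.\<close>

theorem proposition1:
  fixes R :: "('l::finite, 'k::finite, 'n::finite, 'm::finite) covariances"
    and \<rho> s2 :: real
  assumes "\<rho> > 0"
    and "s2 > 0"
    and "\<And>j k l n. hermitian_psd (R j k l n)"
  shows
    "(convex (power_set R \<rho>) \<and> (\<forall>\<gamma>. convex {\<nu>. (\<nu>, \<gamma>) \<in> epigraph_set R \<rho> s2}))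
     \<and>
     (epigraph_set R \<rho> s2 = {(\<nu>, \<gamma>). \<nu> \<in> power_set R \<rho> \<and> \<gamma> \<le> min_sinr R \<rho> s2 \<nu>}
       \<and> quasiconcave_on (power_set R \<rho>) (min_sinr R \<rho> s2))
     \<and>
     (\<forall>\<gamma>>0.
       convex (feasibility_set x_bar R \<rho> s2 \<gamma>)
       \<and> convex (feasibility_set x_bar_once R \<rho> s2 \<gamma>)
       \<and> (\<forall>\<nu>.
           ((\<nu>, \<gamma>) \<in> epigraph_set R \<rho> s2 \<longleftrightarrow>
             (\<forall>j k. norm (x_tilde R \<rho> j k \<nu>, x_bar_once j k (exact_aux R \<rho> \<nu>), sqrt s2)
                      \<le> 1 / sqrt \<gamma> * signal R \<rho> \<nu> j k) \<and> \<nu> \<in> power_set R \<rho>)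
           \<and> ((\<exists>\<rho>x. (\<nu>, \<rho>x) \<in> feasibility_set x_bar R \<rho> s2 \<gamma>) \<longrightarrow> (\<nu>, \<gamma>) \<in> epigraph_set R \<rho> s2)
           \<and> ((\<exists>\<rho>x. (\<nu>, \<rho>x) \<in> feasibility_set x_bar_once R \<rho> s2 \<gamma>) \<longrightarrow> (\<nu>, \<gamma>) \<in> epigraph_set R \<rho> s2)
           \<and> (aligned_xi R \<rho> \<and> CARD('k) = 1 \<longrightarrow>
               ((\<nu>, \<gamma>) \<in> epigraph_set R \<rho> s2 \<longleftrightarrow> (\<exists>\<rho>x. (\<nu>, \<rho>x) \<in> feasibility_set x_bar R \<rho> s2 \<gamma>)))
           \<and> (aligned_xi R \<rho> \<longrightarrow>
               ((\<nu>, \<gamma>) \<in> epigraph_set R \<rho> s2 \<longleftrightarrow> (\<exists>\<rho>x. (\<nu>, \<rho>x) \<in> feasibility_set x_bar_once R \<rho> s2 \<gamma>)))))"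
proof -
  interpret downlink_system R \<rho> s2
    by unfold_locales (fact assms)+
  have epigraph: "epigraph_set R \<rho> s2 = {(\<nu>, \<gamma>). \<nu> \<in> power_set R \<rho> \<and> \<gamma> \<le> min_sinr R \<rho> s2 \<nu>}"
    by (auto simp: epigraph_set_def le_min_sinr_iff)
  have one_user: "feasibility_set x_bar R \<rho> s2 \<gamma> = feasibility_set x_bar_once R \<rho> s2 \<gamma>"
    if "CARD('k) = 1" for \<gamma>
    by (simp add: feasibility_set_def x_bar_eq_x_bar_once[OF that])
  show ?thesis
  proof (intro conjI allI impI)
    fix \<gamma> :: real and \<nu> :: "('l, 'k, 'n) coeffs"
    assume \<gamma>: "\<gamma> > 0"
    show "(\<nu>, \<gamma>) \<in> epigraph_set R \<rho> s2 \<longleftrightarrow>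
      (\<forall>j k. norm (x_tilde R \<rho> j k \<nu>, x_bar_once j k (exact_aux R \<rho> \<nu>), sqrt s2)
        \<le> 1 / sqrt \<gamma> * signal R \<rho> \<nu> j k) \<and> \<nu> \<in> power_set R \<rho>"
      using epigraph_iff[OF \<gamma>] by (simp only: interference_def)
    show once: "(\<nu>, \<gamma>) \<in> epigraph_set R \<rho> s2"
      if "\<exists>p. (\<nu>, p) \<in> feasibility_set x_bar_once R \<rho> s2 \<gamma>"
      using that feasible_imp_epigraph[OF \<gamma>] by blast
    show "(\<nu>, \<gamma>) \<in> epigraph_set R \<rho> s2"
      if "\<exists>p. (\<nu>, p) \<in> feasibility_set x_bar R \<rho> s2 \<gamma>"
      using that feasible_x_bar_imp_once once by blast
    show aligned: "(\<nu>, \<gamma>) \<in> epigraph_set R \<rho> s2 \<longleftrightarrow>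
        (\<exists>p. (\<nu>, p) \<in> feasibility_set x_bar_once R \<rho> s2 \<gamma>)" if "aligned_xi R \<rho>"
      using once epigraph_imp_feasible[OF \<gamma> _ that] by blast
    show "(\<nu>, \<gamma>) \<in> epigraph_set R \<rho> s2 \<longleftrightarrow>
        (\<exists>p. (\<nu>, p) \<in> feasibility_set x_bar R \<rho> s2 \<gamma>)" if "aligned_xi R \<rho> \<and> CARD('k) = 1"
      using that aligned one_user by simp
    show "convex (feasibility_set x_bar R \<rho> s2 \<gamma>)"
      by (rule convex_feasibility_set[OF x_bar_lin])
    show "convex (feasibility_set x_bar_once R \<rho> s2 \<gamma>)"
      by (rule convex_feasibility_set[OF x_bar_once_lin])
  qed (fact convex_power_set convex_epigraph_level epigraph quasiconcave_min_sinr)+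
qed

end
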